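(* Let $k\ge 1$ be an integer and let $a,b\in\mathbb{R}$ with $b\neq 0$. Write $a\pm ib=re^{\pm i\theta}$ with $r>0$ and $\theta\in\mathbb{R}$. Let $$f_0[n]=\mathcal{Z}^{-1}\left(\frac{1}{\left(z^2-2az+(a^2+b^2)\right)^k}\right)$$ be the inverse unilateral $\mathcal{Z}$-transform. Then for every integer $n\ge 0$, $$f_0[n]=\frac{2\,(-1)^{k-1}r^{n-2k}}{(2\sin\theta)^{2k-1}}\sum_{j=0}^{k-1}(-1)^j\binom{n-1}{j}\binom{n-(k+1+j)}{k-1-j}\sin\left((n-2j-1)\theta\right).$$
   Context: Unilateral $\mathcal{Z}$-transform: for a sequence $x[n]$, $n=0,1,2,\dots$, $X(z)=\mathcal{Z}(x)(z)=\sum_{n=0}^{\infty}x[n]z^{-n}$, for $|z|$ sufficiently large. The inverse $\mathcal{Z}^{-1}(X)$ of a rational function $X$ (with numerator degree at most the denominator degree) is the unique sequence $(x[n])_{n\ge 0}$ whose transform equals $X(z)$ for all $|z|$ sufficiently large. Binomial convention: for integers $\nu$ and $\kappa\ge 0$, $\binom{\nu}{\kappa}=\frac{\nu(\nu-1)\cdots(\nu-\kappa+1)}{\kappa!}$ if $\kappa\le\nu$, and $\binom{\nu}{\kappa}=0$ whenever $\kappa>\nu$ (in particular $\binom{\nu}{\kappa}=0$ for all $\nu<0$, $\kappa\ge 0$). *)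

theory Defs
  imports "HOL-Analysis.Analysis"
begin

definition has_ztransform :: "(nat \<Rightarrow> complex) \<Rightarrow> (complex \<Rightarrow> complex) \<Rightarrow> bool" where
  "has_ztransform x X \<longleftrightarrow>
     (\<forall>\<^sub>F z in at_infinity. (\<lambda>n. x n * z powi (- int n)) sums X z)"

text \<open>Only the values of \<open>X\<close> near infinity matter. The description is well defined for
  every \<open>X\<close> that is a Z-transform at all, by \<open>has_ztransform_unique\<close> below.\<close>

definition inv_ztransform :: "(complex \<Rightarrow> complex) \<Rightarrow> nat \<Rightarrow> complex" where
  "inv_ztransform X = (THE x. has_ztransform x X)"

lemma has_ztransform_unique:
  assumes "has_ztransform x X" "has_ztransform y X"
  shows "x = y"
proof -
  have "\<forall>\<^sub>F z in at_infinity. (\<lambda>n. (x n - y n) * z powi (- int n)) sums 0"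
    using assms unfolding has_ztransform_def
  proof eventually_elim
    case (elim z)
    from sums_diff[OF elim] show ?case by (simp add: algebra_simps)
  qed
  then obtain R where R: "\<And>z. norm z \<ge> R \<Longrightarrow> (\<lambda>n. (x n - y n) * z powi (- int n)) sums 0"
    unfolding eventually_at_infinity by blast
  define e where "e = 1 / (\<bar>R\<bar> + 1)"
  have e: "e > 0" by (simp add: e_def)
  have S: "(\<lambda>n. (x n - y n) * w ^ n) sums 0" if w: "w \<noteq> 0" "norm w < e" for w
  proof -
    have "norm (inverse w) \<ge> R"
    proof -
      have "norm w * (\<bar>R\<bar> + 1) < 1" using w by (simp add: e_def field_simps)
      then have "\<bar>R\<bar> + 1 < inverse (norm w)" using w by (simp add: field_simps)
      then show ?thesis by (simp add: norm_inverse)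
    qed
    from R[OF this] show ?thesis by (simp add: power_int_minus power_inverse)
  qed
  have "x n - y n = 0" for n
  proof (induction n rule: less_induct)
    case (less n)
    define c where "c m = x (m + n) - y (m + n)" for m
    have C: "(\<lambda>m. c m * w ^ m) sums 0" if w: "w \<noteq> 0" "norm w < e" for w
    proof -
      have "(\<lambda>m. (x (m + n) - y (m + n)) * w ^ (m + n)) sums
              (0 - (\<Sum>i<n. (x i - y i) * w ^ i))"
        using S[OF w] by (subst sums_iff_shift) simp
      also have "(\<Sum>i<n. (x i - y i) * w ^ i) = 0" using less by (intro sum.neutral) auto
      finally have "(\<lambda>m. w ^ n * (c m * w ^ m)) sums (w ^ n * 0)"
        by (simp add: c_def power_add mult_ac)
      then show ?thesis using w by (subst (asm) sums_mult_iff) auto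
    qed
    have "((\<lambda>_. 0) \<longlongrightarrow> c 0) (at (0::complex))"
      by (rule powser_limit_0_strong[OF e]) (use C in \<open>auto simp: dist_norm\<close>)
    then have "c 0 = 0" by (simp add: tendsto_const_iff)
    then show ?case by (simp add: c_def)
  qed
  then show ?thesis by auto
qed

text \<open>Unlike \<open>gbinomial\<close>, this vanishes for every negative upper argument, also when \<open>\<kappa> = 0\<close>.\<close>

definition binom :: "int \<Rightarrow> nat \<Rightarrow> real" where
  "binom \<nu> \<kappa> = (if int \<kappa> \<le> \<nu> then of_int \<nu> gchoose \<kappa> else 0)"

end

theory Submission
  imports Defs
begin

text \<open>
  Dividing a transform by \<open>z\<^sup>2 - 2 * a * z + r\<^sup>2\<close> amounts to solving the recurrence
  \<open>y (n + 2) - 2 * a * y (n + 1) + r\<^sup>2 * y n = x n\<close> with \<open>y 0 = y 1 = 0\<close>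
  (\<open>has_ztransform_second_order_recurrence\<close>). Since \<open>a = r * cos \<theta>\<close> and
  \<open>a\<^sup>2 + b\<^sup>2 = r\<^sup>2\<close>, the \<open>k\<close>-th inverse transform arises from the unit impulse by solving this
  recurrence \<open>k\<close> times. It therefore suffices that the claimed closed forms for \<open>k\<close> and \<open>k + 1\<close> are
  linked by the recurrence and that the one for \<open>k = 1\<close> answers the impulse.

  After the powers of \<open>r\<close> and \<open>2 * sin \<theta>\<close> are removed, the link is an identity between sine sums
  (\<open>sine_sum_recurrence\<close>). Both multiplication by \<open>2 * cos \<theta>\<close> and multiplication by
  \<open>- 4 * (sin \<theta>)\<^sup>2\<close> turn \<open>sin (m * \<theta>)\<close> into a combination of sines of neighbouring multiples of
  \<open>\<theta>\<close>, so coefficients can be compared; the comparison is Pascal's rule applied to each of the two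
  binomial factors (\<open>sine_coeff_recurrence\<close>).

  The binomials in this identity are polynomials in \<open>n\<close>, which makes it valid for every integer
  \<open>n\<close>. The convention that binomials vanish when the lower argument exceeds the upper one cuts the
  closed form off at \<open>n < 2 * k\<close> instead. The cut-off is compatible with the recurrence because the
  polynomial version already vanishes at \<open>2 * k - 1\<close> and \<open>2 * k - 2\<close>
  (\<open>sine_sum_eq_0_odd\<close>, \<open>sine_sum_eq_0_even\<close>), the only indices below \<open>2 * k\<close> that the recurrence
  connects with indices at or beyond \<open>2 * k\<close>.
\<close>

section \<open>Transforms of solutions of a second-order recurrence\<close>

text \<open>Shifting a sequence that starts with zeros multiplies its transform by \<open>z\<close>, so the recurrence
  becomes \<open>(z\<^sup>2 + p * z + q) * Y z = X z\<close>. What needs an argument is that the series of \<open>y\<close>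
  converges at all: the exponential growth bound that \<open>x\<close> has by convergence of its own series is
  inherited by \<open>y\<close>.\<close>

lemma has_ztransform_second_order_recurrence:
  fixes x y :: "nat \<Rightarrow> complex"
  assumes X: "has_ztransform x X"
    and init: "y 0 = 0" "y 1 = 0"
    and rec: "\<And>n. y (n + 2) + p * y (n + 1) + q * y n = x n"
  shows "has_ztransform y (\<lambda>z. X z / (z\<^sup>2 + p * z + q))"
proof -
  obtain R0 where R0: "\<And>z. norm z \<ge> R0 \<Longrightarrow> (\<lambda>n. x n * z powi (- int n)) sums X z"
    using X unfolding has_ztransform_def eventually_at_infinity by blast
  \<comment> \<open>The second entry ensures \<open>1 + norm p * R + norm q \<le> R\<^sup>2\<close>, which carries the growth bound
      through the recurrence, and keeps \<open>z\<^sup>2 + p * z + q\<close> away from \<open>0\<close> beyond \<open>R\<close>.\<close>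
  define R where "R = max R0 (1 + norm p + norm q)"
  have R: "R \<ge> 1 + norm p + norm q" "R \<ge> R0" "R \<ge> 1"
    by (auto simp: R_def intro: order_trans[OF _ max.cobounded2])
  have "summable (\<lambda>n. x n * complex_of_real R powi (- int n))"
    using R0[of "of_real R"] R by (auto simp: sums_iff)
  then have "Bseq (\<lambda>n. x n * complex_of_real R powi (- int n))"
    using summable_LIMSEQ_zero convergent_imp_Bseq convergentI by blast
  then obtain C where C: "C > 0" "\<And>n. norm (x n * complex_of_real R powi (- int n)) \<le> C"
    unfolding Bseq_def by blast
  have x_bound: "norm (x n) \<le> C * R ^ n" for n
    using C(2)[of n] R(3) by (simp add: norm_mult norm_power_int power_int_minus norm_power
        norm_inverse norm_divide field_simps)
  have y_bound: "norm (y n) \<le> C * R ^ n" for n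
  proof (induction n rule: less_induct)
    case (less n)
    consider "n = 0" | "n = 1" | m where "n = m + 2"
      by (metis One_nat_def add_2_eq_Suc' not0_implies_Suc)
    then show ?case
    proof cases
      case (3 m)
      have "y n = x m - p * y (m + 1) - q * y m"
        using rec[of m] 3 by (simp add: algebra_simps)
      then have "norm (y n) \<le> norm (x m) + norm p * norm (y (m + 1)) + norm q * norm (y m)"
        by (metis (no_types, opaque_lifting) add_mono_thms_linordered_semiring(3) norm_mult
            norm_triangle_ineq4 order_trans)
      also have "\<dots> \<le> C * R ^ m + norm p * (C * R ^ (m + 1)) + norm q * (C * R ^ m)"
        using 3 by (intro add_mono mult_left_mono x_bound less) auto
      also have "\<dots> = C * R ^ m * (1 + norm p * R + norm q)"
        by (simp add: algebra_simps)
      also have "\<dots> \<le> C * R ^ m * (R * R)"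
      proof (intro mult_left_mono)
        have "1 + norm p * R + norm q \<le> R * (1 + norm p + norm q)"
          using mult_right_mono[OF R(3), of "norm q"] R(3) by (simp add: algebra_simps)
        also have "\<dots> \<le> R * R" using R by (intro mult_left_mono) auto
        finally show "1 + norm p * R + norm q \<le> R * R" .
      qed (use C R in auto)
      finally show ?thesis by (simp add: 3 algebra_simps)
    qed (use C R init in auto)
  qed
  have "(\<lambda>n. y n * z powi (- int n)) sums (X z / (z\<^sup>2 + p * z + q))" if z: "norm z \<ge> R + 1" for z
  proof -
    have z_pos: "norm z > 0" and [simp]: "z \<noteq> 0" using z R by auto
    have "summable (\<lambda>n. C * (R / norm z) ^ n)"
      using z R by (intro summable_mult summable_geometric) auto
    moreover have "norm (y n * z powi (- int n)) \<le> C * (R / norm z) ^ n" for n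
      using mult_right_mono[OF y_bound[of n], of "norm z powi (- int n)"] z_pos
      by (simp add: norm_mult norm_power_int power_int_minus norm_power norm_inverse
          norm_divide power_divide field_simps)
    ultimately have "summable (\<lambda>n. y n * z powi (- int n))"
      by (rule summable_comparison_test'[where N = 0])
    then obtain Y where Y: "(\<lambda>n. y n * z powi (- int n)) sums Y"
      by (auto simp: summable_def)
    have shift: "z ^ d * (c * z powi (- int (n + d))) = c * z powi (- int n)" for c n d
      unfolding power_int_minus power_int_of_nat by (simp add: power_add)
    have Y1: "(\<lambda>n. y (n + 1) * z powi (- int n)) sums (z * Y)"
    proof -
      have "(\<lambda>n. y (n + 1) * z powi (- int (n + 1))) sums Y"
        using Y init by (subst sums_iff_shift) simp
      from sums_mult[OF this, of "z ^ 1"] show ?thesis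
        unfolding shift by simp
    qed
    have Y2: "(\<lambda>n. y (n + 2) * z powi (- int n)) sums (z\<^sup>2 * Y)"
    proof -
      have "(\<lambda>n. y (n + 2) * z powi (- int (n + 2))) sums Y"
        using Y init by (subst sums_iff_shift) (simp add: numeral_2_eq_2)
      from sums_mult[OF this, of "z\<^sup>2"] show ?thesis
        unfolding shift .
    qed
    have "(\<lambda>n. y (n + 2) * z powi (- int n) + p * (y (n + 1) * z powi (- int n))
            + q * (y n * z powi (- int n))) sums (z\<^sup>2 * Y + p * (z * Y) + q * Y)"
      by (intro sums_add sums_mult Y Y1 Y2)
    also have "(\<lambda>n. y (n + 2) * z powi (- int n) + p * (y (n + 1) * z powi (- int n))
            + q * (y n * z powi (- int n))) = (\<lambda>n. x n * z powi (- int n))"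
      by (simp add: rec[symmetric] algebra_simps)
    finally have "X z = z\<^sup>2 * Y + p * (z * Y) + q * Y"
      using R0[of z] R(2) z by (intro sums_unique2) auto
    then have XY: "X z = (z\<^sup>2 + p * z + q) * Y" by (simp add: algebra_simps)
    have "z\<^sup>2 + p * z + q \<noteq> 0"
    proof
      assume "z\<^sup>2 + p * z + q = 0"
      then have "z\<^sup>2 = - (p * z + q)" by (simp only: eq_neg_iff_add_eq_0 add.assoc)
      then have "norm z ^ 2 \<le> norm p * norm z + norm q"
        by (metis norm_minus_cancel norm_mult norm_power norm_triangle_ineq)
      also have "\<dots> \<le> norm z * (norm p + norm q)"
        using mult_right_mono[of 1 "norm z" "norm q"] z R(3) by (simp add: algebra_simps)
      also have "\<dots> < norm z * norm z"
        using z R z_pos by (intro mult_strict_left_mono) auto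
      finally show False by (simp add: power2_eq_square)
    qed
    then show ?thesis using Y XY by simp
  qed
  then show ?thesis
    unfolding has_ztransform_def eventually_at_infinity by blast
qed

lemma has_ztransform_delta: "has_ztransform (\<lambda>n. if n = 0 then 1 else 0) (\<lambda>_. 1)"
proof -
  have "(\<lambda>n. (if n = 0 then 1 else 0) * z powi (- int n)) sums 1" for z :: complex
  proof -
    have "(\<lambda>n. (if n = 0 then 1 else 0) * z powi (- int n)) = (\<lambda>n. if n = 0 then 1 else 0)"
      by auto
    then show ?thesis using sums_single[of 0 "\<lambda>_. 1 :: complex"] by simp
  qed
  then show ?thesis unfolding has_ztransform_def by simp
qed

section \<open>The sine sum\<close>

text \<open>Negative lower arguments give \<open>0\<close>, so that Pascal's rule holds without side conditions and
  sums over \<open>j\<close> can be shifted freely.\<close>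

definition int_choose :: "real \<Rightarrow> int \<Rightarrow> real" where
  "int_choose x i = (if i < 0 then 0 else x gchoose nat i)"

lemma int_choose_Pascal: "int_choose (x + 1) i = int_choose x i + int_choose x (i - 1)"
proof (cases "i \<le> 0")
  case False
  then obtain m where "i = int (Suc m)" by (metis gr0_implies_Suc not_le pos_int_cases)
  then show ?thesis
    using gbinomial_Suc_Suc[of x m] by (simp add: int_choose_def nat_add_distrib)
qed (auto simp: int_choose_def)

lemma int_choose_eq_0:
  assumes "0 \<le> m" "m < i"
  shows "int_choose (of_int m) i = 0"
proof -
  have "real (nat m) gchoose nat i = of_nat (nat m choose nat i)" by (simp add: binomial_gbinomial)
  also have "nat m choose nat i = 0" using assms by (simp add: binomial_eq_0)
  finally show ?thesis using assms by (simp add: int_choose_def)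
qed

definition sine_coeff :: "int \<Rightarrow> int \<Rightarrow> int \<Rightarrow> real" where
  "sine_coeff k n j =
     (-1) powi j * int_choose (of_int (n - 1)) j * int_choose (of_int (n - k - 1 - j)) (k - 1 - j)"

definition sine_sum :: "real \<Rightarrow> int \<Rightarrow> int \<Rightarrow> real" where
  "sine_sum \<theta> k n = (\<Sum>j\<in>{0..k-1}. sine_coeff k n j * sin (of_int (n - 1 - 2 * j) * \<theta>))"

lemma sine_coeff_outside: "j < 0 \<or> j \<ge> k \<Longrightarrow> sine_coeff k n j = 0"
  by (auto simp: sine_coeff_def int_choose_def)

text \<open>Reduce all upper arguments to \<open>N = n - 1\<close> in the first factor and to \<open>M = n - k - 1 - j\<close> in the
  second by Pascal's rule. Both sides then are the same combination of the products of
  \<open>int_choose N i\<close> for \<open>i \<in> {j - 2..j}\<close> with \<open>int_choose M i\<close> for \<open>i \<in> {k - 1 - j..k + 1 - j}\<close>.\<close>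

lemma sine_coeff_recurrence:
  "sine_coeff (k + 1) (n + 2) j - sine_coeff (k + 1) (n + 1) j
     - sine_coeff (k + 1) (n + 1) (j - 1) + sine_coeff (k + 1) n (j - 1)
   = sine_coeff k n j - 2 * sine_coeff k n (j - 1) + sine_coeff k n (j - 2)"
proof -
  define N where "N = real_of_int (n - 1)"
  define M where "M = real_of_int (n - k - 1 - j)"
  define e :: real where "e = (-1) powi j"
  have e: "(-1::real) powi (j - 1) = - e" "(-1::real) powi (j - 2) = e"
    by (simp_all add: e_def power_int_diff)
  have N: "real_of_int (n + 2 - 1) = N + 1 + 1" "real_of_int (n + 1 - 1) = N + 1"
    "real_of_int (n - 1) = N"
    by (simp_all add: N_def)
  have M: "real_of_int (n + 2 - (k + 1) - 1 - j) = M + 1"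
    "real_of_int (n + 1 - (k + 1) - 1 - j) = M"
    "real_of_int (n + 1 - (k + 1) - 1 - (j - 1)) = M + 1"
    "real_of_int (n - (k + 1) - 1 - (j - 1)) = M"
    "real_of_int (n - k - 1 - j) = M"
    "real_of_int (n - k - 1 - (j - 1)) = M + 1"
    "real_of_int (n - k - 1 - (j - 2)) = M + 1 + 1"
    by (simp_all add: M_def)
  have i: "k + 1 - 1 - j = k - j" "k + 1 - 1 - (j - 1) = k - j + 1" "k - 1 - j = k - j - 1"
    "k - 1 - (j - 1) = k - j" "k - 1 - (j - 2) = k - j + 1" "k - j + 1 - 1 = k - j"
    "j - 1 - 1 = j - 2"
    by simp_all
  show ?thesis
    unfolding sine_coeff_def N M i e int_choose_Pascal e_def[symmetric]
    by (simp add: algebra_simps)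
qed

lemma sum_int_shift:
  fixes h :: "int \<Rightarrow> real"
  assumes "\<And>j. j < 0 \<or> j > K \<Longrightarrow> h j = 0" "0 \<le> i" "K + i \<le> L"
  shows "(\<Sum>j\<in>{0..K}. h j) = (\<Sum>j\<in>{0..L}. h (j - i))"
proof -
  have "(\<Sum>j\<in>{0..K}. h j) = (\<Sum>j\<in>{i..K+i}. h (j - i))"
    by (rule sum.reindex_bij_witness[of _ "\<lambda>j. j - i" "\<lambda>j. j + i"]) auto
  also have "\<dots> = (\<Sum>j\<in>{0..L}. h (j - i))"
    by (intro sum.mono_neutral_left) (use assms in auto)
  finally show ?thesis .
qed

text \<open>With \<open>S m = sin (m * \<theta>)\<close>, the addition theorems give
  \<open>2 * cos \<theta> * S m = S (m + 1) + S (m - 1)\<close> and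
  \<open>- 4 * (sin \<theta>)\<^sup>2 * S m = S (m + 2) - 2 * S m + S (m - 2)\<close>. Both sides become combinations of
  the sines \<open>S (n + 1 - 2 * j)\<close> and agree coefficient by coefficient.\<close>

lemma sine_sum_recurrence:
  "sine_sum \<theta> (k + 1) (n + 2) - 2 * cos \<theta> * sine_sum \<theta> (k + 1) (n + 1) + sine_sum \<theta> (k + 1) n
   = - (4 * (sin \<theta>)\<^sup>2) * sine_sum \<theta> k n"
proof -
  define S where "S m = sin (of_int m * \<theta>)" for m :: int
  have cos_S: "2 * cos \<theta> * S m = S (m + 1) + S (m - 1)" for m
    by (simp add: S_def sin_add sin_diff ring_distribs)
  have sin_S: "- (4 * (sin \<theta>)\<^sup>2) * S m = S (m + 2) - 2 * S m + S (m - 2)" for m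
  proof -
    have "S (m + 2) + S (m - 2) = 2 * cos (2 * \<theta>) * S m"
      by (simp add: S_def sin_add sin_diff ring_distribs)
    then have "S (m + 2) - 2 * S m + S (m - 2) = 2 * (1 - 2 * (sin \<theta>)\<^sup>2) * S m - 2 * S m"
      by (simp add: cos_double_sin)
    then show ?thesis by (simp add: algebra_simps)
  qed
  define I where "I = {0..k + 1}"
  let ?c = sine_coeff
  have shift: "(\<Sum>j\<in>{0..K-1}. ?c K m j * S (l - 2 * j))
      = (\<Sum>j\<in>I. ?c K m (j - i) * S (l + 2 * i - 2 * j))"
    if "0 \<le> i" "K - 1 + i \<le> k + 1" for K m l i
  proof -
    have "(\<Sum>j\<in>{0..K-1}. ?c K m j * S (l - 2 * j))
        = (\<Sum>j\<in>I. ?c K m (j - i) * S (l - 2 * (j - i)))"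
      unfolding I_def by (rule sum_int_shift) (use that in \<open>auto simp: sine_coeff_outside\<close>)
    then show ?thesis by (simp add: algebra_simps)
  qed
  have G: "sine_sum \<theta> K m = (\<Sum>j\<in>{0..K-1}. ?c K m j * S (m - 1 - 2 * j))" for K m
    by (simp add: sine_sum_def S_def)
  have 1: "sine_sum \<theta> (k + 1) (n + 2) = (\<Sum>j\<in>I. ?c (k + 1) (n + 2) j * S (n + 1 - 2 * j))"
    unfolding G using shift[of 0 "k + 1" "n + 2" "n + 1"] by (simp add: add.commute)
  have 2: "2 * cos \<theta> * sine_sum \<theta> (k + 1) (n + 1)
      = (\<Sum>j\<in>I. ?c (k + 1) (n + 1) j * S (n + 1 - 2 * j))
      + (\<Sum>j\<in>I. ?c (k + 1) (n + 1) (j - 1) * S (n + 1 - 2 * j))"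
  proof -
    have "2 * cos \<theta> * sine_sum \<theta> (k + 1) (n + 1)
        = (\<Sum>j\<in>{0..k + 1 - 1}. ?c (k + 1) (n + 1) j * (2 * cos \<theta> * S (n + 1 - 1 - 2 * j)))"
      unfolding G sum_distrib_left by (simp add: mult_ac)
    also have "\<dots> = (\<Sum>j\<in>{0..k + 1 - 1}. ?c (k + 1) (n + 1) j * S (n + 1 - 2 * j))
        + (\<Sum>j\<in>{0..k + 1 - 1}. ?c (k + 1) (n + 1) j * S (n - 1 - 2 * j))"
      unfolding cos_S ring_distribs sum.distrib
      by (simp add: algebra_simps)
    also have "\<dots> = (\<Sum>j\<in>I. ?c (k + 1) (n + 1) j * S (n + 1 - 2 * j))
      + (\<Sum>j\<in>I. ?c (k + 1) (n + 1) (j - 1) * S (n + 1 - 2 * j))"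
      using shift[of 0 "k + 1" "n + 1" "n + 1"] shift[of 1 "k + 1" "n + 1" "n - 1"]
      by (simp add: add.commute)
    finally show ?thesis .
  qed
  have 3: "sine_sum \<theta> (k + 1) n = (\<Sum>j\<in>I. ?c (k + 1) n (j - 1) * S (n + 1 - 2 * j))"
    unfolding G using shift[of 1 "k + 1" n "n - 1"] by (simp add: add.commute)
  have 4: "- (4 * (sin \<theta>)\<^sup>2) * sine_sum \<theta> k n
      = (\<Sum>j\<in>I. ?c k n j * S (n + 1 - 2 * j)) - 2 * (\<Sum>j\<in>I. ?c k n (j - 1) * S (n + 1 - 2 * j))
      + (\<Sum>j\<in>I. ?c k n (j - 2) * S (n + 1 - 2 * j))"
  proof -
    have "- (4 * (sin \<theta>)\<^sup>2) * sine_sum \<theta> k n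
        = (\<Sum>j\<in>{0..k - 1}. ?c k n j * (- (4 * (sin \<theta>)\<^sup>2) * S (n - 1 - 2 * j)))"
      unfolding G sum_distrib_left by (simp add: mult_ac)
    also have "\<dots> = (\<Sum>j\<in>{0..k - 1}. ?c k n j * S (n + 1 - 2 * j))
        - 2 * (\<Sum>j\<in>{0..k - 1}. ?c k n j * S (n - 1 - 2 * j))
        + (\<Sum>j\<in>{0..k - 1}. ?c k n j * S (n - 3 - 2 * j))"
      unfolding sin_S sum_distrib_left sum.distrib[symmetric] sum_subtractf[symmetric]
      by (intro sum.cong) (simp_all add: algebra_simps)
    also have "\<dots> = (\<Sum>j\<in>I. ?c k n j * S (n + 1 - 2 * j))
        - 2 * (\<Sum>j\<in>I. ?c k n (j - 1) * S (n + 1 - 2 * j))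
        + (\<Sum>j\<in>I. ?c k n (j - 2) * S (n + 1 - 2 * j))"
      using shift[of 0 k n "n + 1"] shift[of 1 k n "n - 1"] shift[of 2 k n "n - 3"]
      by (simp add: add.commute)
    finally show ?thesis .
  qed
  show ?thesis
    unfolding 1 2 3 4 sum_distrib_left sum.distrib[symmetric] sum_subtractf[symmetric]
  proof (intro sum.cong refl)
    fix j
    show "?c (k + 1) (n + 2) j * S (n + 1 - 2 * j)
        - (?c (k + 1) (n + 1) j * S (n + 1 - 2 * j) + ?c (k + 1) (n + 1) (j - 1) * S (n + 1 - 2 * j))
        + ?c (k + 1) n (j - 1) * S (n + 1 - 2 * j)
      = ?c k n j * S (n + 1 - 2 * j) - 2 * (?c k n (j - 1) * S (n + 1 - 2 * j))
        + ?c k n (j - 2) * S (n + 1 - 2 * j)"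
      using arg_cong[OF sine_coeff_recurrence[of k n j], of "\<lambda>t. t * S (n + 1 - 2 * j)"]
      by (simp add: algebra_simps)
  qed
qed

text \<open>At \<open>n = 2 * k - 1\<close> the second binomial factor is \<open>k - 2 - j\<close> over \<open>k - 1 - j\<close>, hence \<open>0\<close>
  unless \<open>j = k - 1\<close>, and the last summand contains \<open>sin 0\<close>.\<close>

lemma sine_sum_eq_0_odd: "sine_sum \<theta> k (2 * k - 1) = 0"
  unfolding sine_sum_def
proof (intro sum.neutral ballI)
  fix j assume j: "j \<in> {0..k-1}"
  show "sine_coeff k (2 * k - 1) j * sin (of_int (2 * k - 1 - 1 - 2 * j) * \<theta>) = 0"
  proof (cases "j = k - 1")
    case False
    then have "int_choose (of_int (2 * k - 1 - k - 1 - j)) (k - 1 - j) = 0"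
      using j by (intro int_choose_eq_0) auto
    then show ?thesis by (simp only: sine_coeff_def mult_zero_left mult_zero_right)
  qed simp
qed

text \<open>Only the summands for \<open>j = k - 1\<close> and \<open>j = k\<close> survive, with second factors \<open>-1\<close> over \<open>1\<close> and
  \<open>-2\<close> over \<open>0\<close>. Their sines are opposite, and they
  cancel because \<open>2 * k - 1\<close> over \<open>k - 1\<close> equals \<open>2 * k - 1\<close> over \<open>k\<close>.\<close>

lemma sine_sum_eq_0_even:
  assumes "k \<ge> 1"
  shows "sine_sum \<theta> (k + 1) (2 * k) = 0"
proof -
  let ?f = "\<lambda>j. sine_coeff (k + 1) (2 * k) j * sin (of_int (2 * k - 1 - 2 * j) * \<theta>)"
  have "sine_sum \<theta> (k + 1) (2 * k) = sum ?f {k - 1, k}"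
    unfolding sine_sum_def
  proof (intro sum.mono_neutral_right ballI)
    fix j assume j: "j \<in> {0..k + 1 - 1} - {k - 1, k}"
    have "int_choose (of_int (2 * k - (k + 1) - 1 - j)) (k + 1 - 1 - j) = 0"
      using j by (intro int_choose_eq_0) auto
    then show "?f j = 0" by (simp only: sine_coeff_def mult_zero_left mult_zero_right)
  qed (use assms in auto)
  also have "\<dots> = ?f (k - 1) + ?f k" by simp
  also have "sine_coeff (k + 1) (2 * k) (k - 1) = (-1) powi k * int_choose (of_int (2 * k - 1)) (k - 1)"
    by (simp add: sine_coeff_def int_choose_def power_int_diff)
  also have "sine_coeff (k + 1) (2 * k) k = (-1) powi k * int_choose (of_int (2 * k - 1)) k"
    by (simp add: sine_coeff_def int_choose_def)
  also have "int_choose (of_int (2 * k - 1)) (k - 1) = int_choose (of_int (2 * k - 1)) k"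
  proof -
    obtain m where m: "k = int (Suc m)" using assms by (metis Suc_pred' int_one_le_iff_zero_less pos_int_cases)
    have "Suc (2 * m) choose m = Suc (2 * m) choose Suc m"
      using binomial_symmetric[of m "Suc (2 * m)"] by simp
    then have "real (Suc (2 * m)) gchoose m = real (Suc (2 * m)) gchoose Suc m"
      by (metis binomial_gbinomial)
    then show ?thesis
      by (simp add: m int_choose_def nat_add_distrib algebra_simps)
  qed
  finally show ?thesis by (simp add: algebra_simps)
qed

lemma sine_sum_1: "sine_sum \<theta> 1 n = sin (of_int (n - 1) * \<theta>)"
  by (simp add: sine_sum_def sine_coeff_def int_choose_def)

section \<open>The closed form\<close>

definition closed_form :: "real \<Rightarrow> real \<Rightarrow> nat \<Rightarrow> nat \<Rightarrow> real" where
  "closed_form r \<theta> k n =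
     (if n < 2 * k then 0
      else 2 * (-1) ^ (k - 1) * r powi (int n - 2 * int k) / (2 * sin \<theta>) ^ (2 * k - 1)
             * sine_sum \<theta> (int k) (int n))"

text \<open>The cut-off leaves the formula unchanged already one step before \<open>2 * k\<close>.\<close>

lemma closed_form_ge:
  assumes "k \<ge> 1" "n \<ge> 2 * k - 1"
  shows "closed_form r \<theta> k n =
    2 * (-1) ^ (k - 1) * r powi (int n - 2 * int k) / (2 * sin \<theta>) ^ (2 * k - 1)
             * sine_sum \<theta> (int k) (int n)"
proof (cases "n = 2 * k - 1")
  case True
  then have "int n = 2 * int k - 1" using assms by simp
  then show ?thesis using sine_sum_eq_0_odd[of \<theta> "int k"] assms by (simp add: closed_form_def)
qed (use assms in \<open>simp add: closed_form_def\<close>)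

text \<open>For \<open>n \<ge> 2 * k\<close> none of the three values on the left is affected by the cut-off at
  \<open>2 * (k + 1)\<close>, because the sine sum vanishes at \<open>2 * k\<close> and \<open>2 * k + 1\<close>; the factor
  \<open>- 4 * (sin \<theta>)\<^sup>2\<close> of the sine sum recurrence is absorbed by the prefactor.
  The restriction to \<open>k \<ge> 1\<close> matters at \<open>n = 0\<close>: for \<open>k = 0\<close> the impulse takes the place of the
  empty sine sum.\<close>

lemma closed_form_recurrence:
  assumes "r \<noteq> 0" "sin \<theta> \<noteq> 0" "k \<ge> 1"
  shows "closed_form r \<theta> (Suc k) (n + 2) - 2 * (r * cos \<theta>) * closed_form r \<theta> (Suc k) (n + 1)
           + r\<^sup>2 * closed_form r \<theta> (Suc k) n = closed_form r \<theta> k n"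
proof -
  consider "n < 2 * k" | "n \<ge> 2 * k" by linarith
  then show ?thesis
  proof cases
    case 1
    then show ?thesis by (simp add: closed_form_def)
  next
    case 2
    define K where "K = 2 * (-1) ^ k / (2 * sin \<theta>) ^ (2 * k + 1)"
    define \<rho> where "\<rho> = r powi (int n - 2 * int k)"
    have G: "closed_form r \<theta> (Suc k) m
        = K * r powi (int m - 2 * int k - 2) * sine_sum \<theta> (int k + 1) (int m)" if "m \<ge> 2 * k" for m
    proof (cases "m = 2 * k")
      case True
      then show ?thesis
        using sine_sum_eq_0_even[of "int k" \<theta>] assms(3) by (simp add: closed_form_def)
    next
      case False
      with that have "m \<ge> 2 * Suc k - 1" by simp
      from closed_form_ge[OF _ this, of r \<theta>] show ?thesis
        by (simp add: K_def algebra_simps)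
    qed
    have rho: "r powi (int (n + 2) - 2 * int k - 2) = \<rho>"
      "r powi (int (n + 1) - 2 * int k - 2) = \<rho> / r"
      "r powi (int n - 2 * int k - 2) = \<rho> / r\<^sup>2"
      using assms(1) by (simp_all add: \<rho>_def power_int_diff power_int_add power2_eq_square)
    have "closed_form r \<theta> (Suc k) (n + 2)
        = K * \<rho> * sine_sum \<theta> (int k + 1) (int n + 2)"
      "closed_form r \<theta> (Suc k) (n + 1)
        = K * (\<rho> / r) * sine_sum \<theta> (int k + 1) (int n + 1)"
      "closed_form r \<theta> (Suc k) n
        = K * (\<rho> / r\<^sup>2) * sine_sum \<theta> (int k + 1) (int n)"
      using G[of "n + 2"] G[of "n + 1"] G[of n] 2 unfolding rho by (simp_all add: add.commute)
    then have "closed_form r \<theta> (Suc k) (n + 2)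
           - 2 * (r * cos \<theta>) * closed_form r \<theta> (Suc k) (n + 1) + r\<^sup>2 * closed_form r \<theta> (Suc k) n
        = K * \<rho> * (sine_sum \<theta> (int k + 1) (int n + 2)
           - 2 * cos \<theta> * sine_sum \<theta> (int k + 1) (int n + 1) + sine_sum \<theta> (int k + 1) (int n))"
      using assms(1) by (simp add: field_simps)
    also have "\<dots> = K * (- (4 * (sin \<theta>)\<^sup>2)) * \<rho> * sine_sum \<theta> (int k) (int n)"
      unfolding sine_sum_recurrence by simp
    also have "K * (- (4 * (sin \<theta>)\<^sup>2)) = 2 * (-1) ^ (k - 1) / (2 * sin \<theta>) ^ (2 * k - 1)"
    proof -
      obtain m where "k = Suc m" using assms(3) by (metis Suc_le_D One_nat_def)
      then show ?thesis using assms(2) by (simp add: K_def field_simps power2_eq_square)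
    qed
    finally show ?thesis using 2 by (simp add: closed_form_def \<rho>_def)
  qed
qed

lemma closed_form_1_recurrence:
  assumes "r \<noteq> 0" "sin \<theta> \<noteq> 0"
  shows "closed_form r \<theta> 1 (n + 2) - 2 * (r * cos \<theta>) * closed_form r \<theta> 1 (n + 1)
           + r\<^sup>2 * closed_form r \<theta> 1 n = (if n = 0 then 1 else 0)"
proof (cases "n = 0")
  case True
  then show ?thesis using assms by (simp add: closed_form_def sine_sum_1)
next
  case False
  have F: "closed_form r \<theta> 1 m = r powi (int m - 2) / sin \<theta> * sin ((real m - 1) * \<theta>)"
    if "m \<ge> 1" for m
    using closed_form_ge[of 1 m r \<theta>] that by (simp add: sine_sum_1)
  define \<rho> where "\<rho> = r powi int n"
  have rho: "r powi (int (n + 2) - 2) = \<rho>" "r powi (int (n + 1) - 2) = \<rho> / r"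
    "r powi (int n - 2) = \<rho> / r\<^sup>2"
    using assms(1) by (simp_all add: \<rho>_def power_int_diff power_int_add power2_eq_square)
  have F': "closed_form r \<theta> 1 (n + 2) = \<rho> / sin \<theta> * sin ((real n + 1) * \<theta>)"
    "closed_form r \<theta> 1 (n + 1) = \<rho> / r / sin \<theta> * sin (real n * \<theta>)"
    "closed_form r \<theta> 1 n = \<rho> / r\<^sup>2 / sin \<theta> * sin ((real n - 1) * \<theta>)"
    using F[of "n + 2"] F[of "n + 1"] F[of n] False unfolding rho by (simp_all add: add.commute)
  have "closed_form r \<theta> 1 (n + 2) - 2 * (r * cos \<theta>) * closed_form r \<theta> 1 (n + 1)
           + r\<^sup>2 * closed_form r \<theta> 1 n
      = \<rho> / sin \<theta> * (sin ((real n + 1) * \<theta>) - 2 * cos \<theta> * sin (real n * \<theta>)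
           + sin ((real n - 1) * \<theta>))"
    unfolding F' using assms by (simp add: field_simps)
  also have "sin ((real n + 1) * \<theta>) - 2 * cos \<theta> * sin (real n * \<theta>) + sin ((real n - 1) * \<theta>) = 0"
    by (simp add: ring_distribs sin_add sin_diff)
  finally show ?thesis using False by simp
qed

lemma has_ztransform_closed_form:
  assumes "r \<noteq> 0" "sin \<theta> \<noteq> 0" "k \<ge> 1"
  shows "has_ztransform (\<lambda>n. complex_of_real (closed_form r \<theta> k n))
           (\<lambda>z. 1 / (z\<^sup>2 - 2 * of_real (r * cos \<theta>) * z + of_real (r\<^sup>2)) ^ k)"
  using assms(3)
proof (induction k rule: nat_induct_at_least)
  case base
  have "complex_of_real (closed_form r \<theta> 1 (n + 2))
      + - 2 * of_real (r * cos \<theta>) * of_real (closed_form r \<theta> 1 (n + 1))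
      + of_real (r\<^sup>2) * of_real (closed_form r \<theta> 1 n) = (if n = 0 then 1 else 0)" for n
    using arg_cong[OF closed_form_1_recurrence[OF assms(1,2), of n], of complex_of_real]
    by (simp split: if_splits)
  from has_ztransform_second_order_recurrence[OF has_ztransform_delta _ _ this]
  show ?case by (simp add: closed_form_def)
next
  case (Suc k)
  have "complex_of_real (closed_form r \<theta> (Suc k) (n + 2))
      + - 2 * of_real (r * cos \<theta>) * of_real (closed_form r \<theta> (Suc k) (n + 1))
      + of_real (r\<^sup>2) * of_real (closed_form r \<theta> (Suc k) n) = of_real (closed_form r \<theta> k n)" for n
    using arg_cong[OF closed_form_recurrence[OF assms(1,2) Suc.hyps, of n], of complex_of_real]
    by simp
  from has_ztransform_second_order_recurrence[OF Suc.IH _ _ this]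
  show ?case by (simp add: closed_form_def mult.commute)
qed

lemma inv_ztransform_eq:
  assumes "has_ztransform x X"
  shows "inv_ztransform X = x"
  unfolding inv_ztransform_def using assms has_ztransform_unique by blast

text \<open>For \<open>n < 2 * k\<close> the second binomial has its lower argument above the upper one, whatever \<open>j\<close>
  is; for \<open>n \<ge> 2 * k\<close> neither binomial of any summand falls under the vanishing convention.\<close>

lemma closed_form_eq_binom_sum:
  assumes "k \<ge> 1"
  shows "closed_form r \<theta> k n =
     2 * (-1) ^ (k - 1) * r powi (int n - 2 * int k) / (2 * sin \<theta>) ^ (2 * k - 1) *
       (\<Sum>j=0..k-1. (-1) ^ j * binom (int n - 1) j * binom (int n - (int k + 1 + int j)) (k - 1 - j)
          * sin ((real n - 2 * real j - 1) * \<theta>))"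
proof (cases "n < 2 * k")
  case True
  have "binom (int n - (int k + 1 + int j)) (k - 1 - j) = 0" if "j \<in> {0..k-1}" for j
    using that True assms by (auto simp: binom_def)
  then show ?thesis using True by (simp add: closed_form_def)
next
  case False
  have "sine_sum \<theta> (int k) (int n)
      = (\<Sum>j=0..k-1. (-1) ^ j * binom (int n - 1) j * binom (int n - (int k + 1 + int j)) (k - 1 - j)
          * sin ((real n - 2 * real j - 1) * \<theta>))"
    unfolding sine_sum_def
  proof (rule sum.reindex_bij_witness[of _ int nat])
    fix j assume j: "j \<in> {0..int k - 1}"
    then obtain i where i: "j = int i" "i < k" by (metis atLeastAtMost_iff nonneg_int_cases zle_diff1_eq of_nat_less_iff)
    have "nat (int k - 1 - int i) = k - 1 - i" by simp
    then show "(-1) ^ nat j * binom (int n - 1) (nat j)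
          * binom (int n - (int k + 1 + int (nat j))) (k - 1 - nat j)
          * sin ((real n - 2 * real (nat j) - 1) * \<theta>)
        = sine_coeff (int k) (int n) j * sin (of_int (int n - 1 - 2 * j) * \<theta>)"
      using False i(2) by (simp add: i(1) sine_coeff_def int_choose_def binom_def algebra_simps)
  qed (use assms in auto)
  then show ?thesis using False by (simp add: closed_form_def)
qed

theorem theorem3p3:
  fixes k n :: nat and a b r \<theta> :: real
  assumes "k \<ge> 1" and "b \<noteq> 0" and "r > 0"
    and "complex_of_real a + \<i> * of_real b = of_real r * exp (\<i> * of_real \<theta>)"
    and "complex_of_real a - \<i> * of_real b = of_real r * exp (- (\<i> * of_real \<theta>))"
  shows "inv_ztransform
           (\<lambda>z. 1 / (z ^ 2 - 2 * of_real a * z + (of_real a ^ 2 + of_real b ^ 2)) ^ k) n =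
         complex_of_real
           (2 * (-1) ^ (k - 1) * r powi (int n - 2 * int k) / (2 * sin \<theta>) ^ (2 * k - 1) *
            (\<Sum>j=0..k-1. (-1) ^ j * binom (int n - 1) j
                * binom (int n - (int k + 1 + int j)) (k - 1 - j)
                * sin ((real n - 2 * real j - 1) * \<theta>)))"
proof -
  have "complex_of_real a + \<i> * of_real b = of_real r * cis \<theta>"
    using assms(4) by (simp add: cis_conv_exp)
  then have a: "a = r * cos \<theta>" and b: "b = r * sin \<theta>"
    by (simp_all add: complex_eq_iff)
  have "a\<^sup>2 + b\<^sup>2 = r\<^sup>2 * ((cos \<theta>)\<^sup>2 + (sin \<theta>)\<^sup>2)"
    unfolding a b by (simp only: power_mult_distrib distrib_left)
  then have r2: "complex_of_real a ^ 2 + of_real b ^ 2 = of_real (r\<^sup>2)"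
    by (simp flip: of_real_power of_real_add)
  have "sin \<theta> \<noteq> 0" using assms(2) b by auto
  then have "inv_ztransform
      (\<lambda>z. 1 / (z ^ 2 - 2 * of_real a * z + (of_real a ^ 2 + of_real b ^ 2)) ^ k)
      = (\<lambda>n. complex_of_real (closed_form r \<theta> k n))"
    unfolding r2 unfolding a
    using has_ztransform_closed_form[of r \<theta> k] assms(1,3) by (intro inv_ztransform_eq) auto
  then show ?thesis by (simp only: closed_form_eq_binom_sum[OF assms(1)])
qed

end
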